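(* Let $\Sigma$ be a compact bordered surface with boundary components $1,\dots,n$, equipped with an ideal triangulation $T$ with ideal edge set $E$ and ideal face set $F$, and let $l^0\in\mathbb{R}_+^{|E|}$ be a fixed discrete hyperbolic metric. Let $W\subset\mathbb{R}^n$ be the space of admissible discrete conformal factors and let $\psi:W\to\mathbb{R}_+^n$, $\psi(w)=(B_1,\dots,B_n)$, be the boundary-length map. Then $\psi$ is a diffeomorphism from $W$ onto $\mathbb{R}_+^n$.
   Context: Setting: $T^*$ is a triangulation of a closed surface $S$ with vertex set $T^0$, edge set $T^1$, face set $T^2$; $N(T^0)$ is a small open regular disjoint neighborhood of $T^0$; $\Sigma=S\setminus N(T^0)$ is compact with $|T^0|=n$ boundary components, labeled $1,\dots,n$. $T=T^*\cap\Sigma$ is the ideal triangulation; ideal edges $E=T^1\cap\Sigma$, ideal faces $F=T^2\cap\Sigma$. The ideal edge between boundary components $i,j$ is denoted $ij$; the ideal face adjacent to boundary components $i,j,k$ is denoted $ijk$. The intersection of an ideal face with $\partial\Sigma$ consists of B-arcs. A discrete hyperbolic metric is $l\in\mathbb{R}_+^{|E|}$, $ij\mapsto l_{ij}>0$. For each ideal face $ijk$ there is a right-angled hyperbolic hexagon, unique up to isometry, whose three pairwise non-adjacent sides have lengths $l_{ij},l_{jk},l_{ki}$; gluing these hexagons gives a hyperbolic surface $\Sigma_l$ with geodesic boundary. In the hexagon of face $f=ijk$, $\theta_i^f$ denotes the length of the side opposite to the side of length $l_{jk}$ (the B-arc on boundary component $i$); it satisfies $\cosh\theta_i^f=\frac{\cosh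 l_{jk}+\cosh l_{ki}\cosh l_{ij}}{\sinh l_{ki}\sinh l_{ij}}$. A vector $w\in\mathbb{R}^n$ is an admissible discrete conformal factor if $w_i+w_j>-\ln\cosh\frac{l^0_{ij}}{2}$ for every ideal edge $ij\in E$; $W$ is the (convex, open) set of these. For $w\in W$ the metric $l=w*l^0$ is defined by $\cosh\frac{l_{ij}}{2}=e^{w_i+w_j}\cosh\frac{l^0_{ij}}{2}$. For $w\in W$, $B_i=\sum_{f\in F_i}\theta_i^f$ is the length of boundary component $i$ of $\Sigma_{w*l^0}$, where $F_i$ is the set of ideal faces adjacent to boundary component $i$. *)

theory Defs
  imports "HOL-Analysis.Analysis"
begin

text \<open>Combinatorial model of a triangulation T* of a closed surface as a gluing of
  triangles. Faces are elements of a finite set F. The corners of face f are (f,0),(f,1),(f,2);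
  side (f,c) is the side opposite to corner (f,c); it runs from corner (f,(c+1) mod 3)
  to corner (f,(c+2) mod 3). The sides are glued in pairs by a fixed-point-free involution
  sig; rv s says whether the gluing of side s reverses the above ordering of endpoints.\<close>

definition sides :: "'f set \<Rightarrow> ('f \<times> nat) set" where
  "sides F = F \<times> {0,1,2}"

definition corners :: "'f set \<Rightarrow> ('f \<times> nat) set" where
  "corners F = F \<times> {0,1,2}"

definition nx :: "nat \<Rightarrow> nat \<Rightarrow> nat" where
  "nx k c = (c + k) mod 3"

text \<open>One-step identification of corners induced by the gluing of sides.\<close>
definition corner_glue ::
  "'f set \<Rightarrow> ('f \<times> nat \<Rightarrow> 'f \<times> nat) \<Rightarrow> ('f \<times> nat \<Rightarrow> bool) \<Rightarrow> (('f \<times> nat) \<times> ('f \<times> nat)) set" where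
  "corner_glue F sig rv =
     {((f, nx 1 c), (fst (sig (f,c)), nx (if rv (f,c) then 2 else 1) (snd (sig (f,c))))) | f c. (f,c) \<in> sides F} \<union>
     {((f, nx 2 c), (fst (sig (f,c)), nx (if rv (f,c) then 1 else 2) (snd (sig (f,c))))) | f c. (f,c) \<in> sides F}"

text \<open>The vertices of T* (= boundary components of \<Sigma>) are the classes of corners under the
  equivalence generated by corner_glue; lab labels each corner by its vertex, and every label
  (boundary component) occurs.\<close>
definition triangulated_closed_surface ::
  "'f set \<Rightarrow> ('f \<times> nat \<Rightarrow> 'f \<times> nat) \<Rightarrow> ('f \<times> nat \<Rightarrow> bool) \<Rightarrow> ('f \<times> nat \<Rightarrow> 'v) \<Rightarrow> bool" where
  "triangulated_closed_surface F sig rv lab \<longleftrightarrow>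
     finite F \<and>
     (\<forall>s\<in>sides F. sig s \<in> sides F \<and> sig s \<noteq> s \<and> sig (sig s) = s \<and> rv (sig s) = rv s) \<and>
     (\<forall>x\<in>corners F. \<forall>y\<in>corners F.
        lab x = lab y \<longleftrightarrow> (x, y) \<in> (corner_glue F sig rv \<union> (corner_glue F sig rv)\<inverse>)\<^sup>*) \<and>
     lab ` corners F = UNIV"

text \<open>Endpoints (boundary labels) of the ideal edge carried by side (f,c).\<close>
definition end1 :: "('f \<times> nat \<Rightarrow> 'v) \<Rightarrow> 'f \<times> nat \<Rightarrow> 'v" where
  "end1 lab s = lab (fst s, nx 1 (snd s))"
definition end2 :: "('f \<times> nat \<Rightarrow> 'v) \<Rightarrow> 'f \<times> nat \<Rightarrow> 'v" where
  "end2 lab s = lab (fst s, nx 2 (snd s))"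

text \<open>Discrete hyperbolic metric: positive length on each ideal edge (pair of glued sides).\<close>
definition discrete_hyp_metric :: "'f set \<Rightarrow> ('f \<times> nat \<Rightarrow> 'f \<times> nat) \<Rightarrow> ('f \<times> nat \<Rightarrow> real) \<Rightarrow> bool" where
  "discrete_hyp_metric F sig l \<longleftrightarrow> (\<forall>s\<in>sides F. l s > 0 \<and> l (sig s) = l s)"

text \<open>Admissible discrete conformal factors.\<close>
definition admissible :: "'f set \<Rightarrow> ('f \<times> nat \<Rightarrow> 'v::finite) \<Rightarrow> ('f \<times> nat \<Rightarrow> real) \<Rightarrow> (real^'v) set" where
  "admissible F lab l0 =
     {w. \<forall>s\<in>sides F. w $ end1 lab s + w $ end2 lab s > - ln (cosh (l0 s / 2))}"

text \<open>The metric w * l0: cosh(l/2) = e^(w_i+w_j) cosh(l0/2).\<close>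
definition conf_metric :: "('f \<times> nat \<Rightarrow> 'v::finite) \<Rightarrow> ('f \<times> nat \<Rightarrow> real) \<Rightarrow> real^'v \<Rightarrow> 'f \<times> nat \<Rightarrow> real" where
  "conf_metric lab l0 w s = 2 * arcosh (exp (w $ end1 lab s + w $ end2 lab s) * cosh (l0 s / 2))"

text \<open>Length of the B-arc at corner (f,c) of the right-angled hexagon of face f.\<close>
definition barc :: "('f \<times> nat \<Rightarrow> real) \<Rightarrow> 'f \<times> nat \<Rightarrow> real" where
  "barc l x = (let f = fst x; c = snd x; a = l (f, c); b = l (f, nx 1 c); d = l (f, nx 2 c) in
     arcosh ((cosh a + cosh b * cosh d) / (sinh b * sinh d)))"

text \<open>Boundary length map psi(w) = (B_1,...,B_n); B_i sums the B-arcs over all corners at i.\<close>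
definition bdry_length :: "'f set \<Rightarrow> ('f \<times> nat \<Rightarrow> 'v::finite) \<Rightarrow> ('f \<times> nat \<Rightarrow> real) \<Rightarrow> real^'v \<Rightarrow> real^'v" where
  "bdry_length F lab l0 w = (\<chi> i. \<Sum>x\<in>{x\<in>corners F. lab x = i}. barc (conf_metric lab l0 w) x)"

text \<open>C^k and C^infinity maps between normed spaces (on open sets).\<close>
fun Ck_on :: "nat \<Rightarrow> 'a::real_normed_vector set \<Rightarrow> ('a \<Rightarrow> 'b::real_normed_vector) \<Rightarrow> bool" where
  "Ck_on 0 S f = continuous_on S f"
| "Ck_on (Suc k) S f = ((\<forall>x\<in>S. f differentiable (at x)) \<and>
      (\<forall>v. Ck_on k S (\<lambda>x. frechet_derivative f (at x) v)))"

definition smooth_on :: "'a::real_normed_vector set \<Rightarrow> ('a \<Rightarrow> 'b::real_normed_vector) \<Rightarrow> bool" where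
  "smooth_on S f \<longleftrightarrow> (\<forall>k. Ck_on k S f)"

definition diffeomorphism_onto :: "'a::real_normed_vector set \<Rightarrow> 'b::real_normed_vector set \<Rightarrow> ('a \<Rightarrow> 'b) \<Rightarrow> bool" where
  "diffeomorphism_onto S T f \<longleftrightarrow> open S \<and> open T \<and> bij_betw f S T \<and> smooth_on S f \<and> smooth_on T (inv_into S f)"

end

theory Submission
  imports Defs
begin

text \<open>
  Write \<open>x = cosh l\<close> for the edges of a hexagon, so that a change of the conformal factors gives
  \<open>dx\<^sub>k = 2 (x\<^sub>k + 1) (dw\<^sub>i + dw\<^sub>j)\<close>. The resulting \<open>3 \<times> 3\<close> Jacobian of the B-arcs of a hexagon is negative
  definite, and summing over the hexagons gives \<open>D\<psi>(w) v \<bullet> v < 0\<close> for \<open>v \<noteq> 0\<close>. On the convex set \<open>W\<close> this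
  makes \<open>\<psi>\<close> injective with invertible derivative, so it is open by invariance of domain and its
  inverse is smooth by Cramer's rule.

  Surjectivity follows because the image is open and closed in the connected orthant. For closedness,
  let all \<open>B\<^sub>i\<close> be bounded above and away from 0. Since \<open>cosh \<theta> \<ge> coth l\<close> for the edges adjacent to
  an arc, no edge degenerates; since \<open>cosh \<theta>\<^sub>i\<close> is at least a constant times \<open>exp (- 4 w\<^sub>i)\<close>, no \<open>w\<^sub>i\<close>
  tends to \<open>-\<infinity>\<close>; and once \<open>w\<close> is bounded below, \<open>w\<^sub>i \<rightarrow> \<infinity>\<close> would force \<open>B\<^sub>i \<rightarrow> 0\<close>.
\<close>

section \<open>Calculus of \<open>C\<^sup>k\<close> maps\<close>

text \<open>Openness turns equality on \<open>S\<close> into equality near each point, so the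
  derivatives agree too. This transports closed formulas that hold only on \<open>S\<close>, such as
  those for square root and arcosh.\<close>

lemma Ck_on_cong:
  assumes "open S" "Ck_on k S f" "\<And>x. x \<in> S \<Longrightarrow> f x = g x"
  shows "Ck_on k S g"
  using assms(2,3)
proof (induction k arbitrary: f g)
  case 0
  then show ?case by (simp cong: continuous_on_cong)
next
  case (Suc k)
  have D: "(g has_derivative frechet_derivative f (at x)) (at x)" if "x \<in> S" for x
  proof (rule has_derivative_transform_within_open[OF _ \<open>open S\<close> that Suc.prems(2)])
    show "(f has_derivative frechet_derivative f (at x)) (at x)"
      using Suc.prems(1) that frechet_derivative_works[of f "at x"] by simp
  qed
  have "Ck_on k S (\<lambda>x. frechet_derivative g (at x) v)" for v
  proof (rule Suc.IH)
    show "Ck_on k S (\<lambda>x. frechet_derivative f (at x) v)" using Suc.prems(1) by simp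
    show "frechet_derivative f (at x) v = frechet_derivative g (at x) v" if "x \<in> S" for x
      by (rule fun_cong[OF frechet_derivative_at[OF D[OF that]]])
  qed
  then show ?case using D unfolding Ck_on.simps(2) differentiable_def by blast
qed

text \<open>Replaces the choice-based \<open>frechet_derivative\<close> by an explicit derivative
  \<open>D\<close>, to which an induction on \<open>k\<close> can be applied.\<close>

lemma Ck_on_SucI:
  assumes "open S" "\<And>x. x \<in> S \<Longrightarrow> (f has_derivative D x) (at x)"
    and "\<And>v. Ck_on k S (\<lambda>x. D x v)"
  shows "Ck_on (Suc k) S f"
proof -
  have "Ck_on k S (\<lambda>x. frechet_derivative f (at x) v)" for v
    by (rule Ck_on_cong[OF assms(1) assms(3)[of v]])
      (rule fun_cong[OF frechet_derivative_at[OF assms(2)]])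
  then show ?thesis using assms(2) unfolding Ck_on.simps(2) differentiable_def by blast
qed

lemma Ck_on_has_derivative:
  assumes "Ck_on (Suc k) S f" "x \<in> S"
  shows "(f has_derivative frechet_derivative f (at x)) (at x)"
  using assms frechet_derivative_works[of f "at x"] by simp

lemma Ck_on_SucD: "Ck_on (Suc k) S f \<Longrightarrow> Ck_on k S f"
proof (induction k arbitrary: f)
  case 0
  then show ?case
    by (auto intro!: continuous_at_imp_continuous_on differentiable_imp_continuous_within)
next
  case (Suc k)
  show ?case
    unfolding Ck_on.simps(2)[of k] using Suc.IH Suc.prems unfolding Ck_on.simps(2)[of "Suc k"] by blast
qed

lemma Ck_on_const: "open S \<Longrightarrow> Ck_on k S (\<lambda>x. c)"
proof (induction k arbitrary: c)
  case (Suc k)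
  then show ?case by (intro Ck_on_SucI[where D = "\<lambda>x v. 0"]) auto
qed simp

lemma Ck_on_add:
  assumes "open S" "Ck_on k S f" "Ck_on k S g"
  shows "Ck_on k S (\<lambda>x. f x + g x)"
  using assms(2,3)
proof (induction k arbitrary: f g)
  case (Suc k)
  have "Ck_on k S (\<lambda>x. frechet_derivative f (at x) v)" "Ck_on k S (\<lambda>x. frechet_derivative g (at x) v)" for v
    using Suc.prems by simp_all
  then show ?case
    by (intro Ck_on_SucI[OF assms(1) has_derivative_add[OF
            Ck_on_has_derivative[OF Suc.prems(1)] Ck_on_has_derivative[OF Suc.prems(2)]]] Suc.IH)
qed (auto intro!: continuous_intros)

lemma Ck_on_scaleR:
  fixes f :: "'a::real_normed_vector \<Rightarrow> real"
  assumes "open S" "Ck_on k S f" "Ck_on k S g"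
  shows "Ck_on k S (\<lambda>x. f x *\<^sub>R g x)"
  using assms(2,3)
proof (induction k arbitrary: f g)
  case (Suc k)
  have "Ck_on k S (\<lambda>x. frechet_derivative f (at x) v)" "Ck_on k S (\<lambda>x. frechet_derivative g (at x) v)" for v
    using Suc.prems by simp_all
  then show ?case
    by (intro Ck_on_SucI[OF assms(1) has_derivative_scaleR[OF
            Ck_on_has_derivative[OF Suc.prems(1)] Ck_on_has_derivative[OF Suc.prems(2)]]]
         Ck_on_add Suc.IH assms(1) Ck_on_SucD[OF Suc.prems(1)] Ck_on_SucD[OF Suc.prems(2)])
qed (auto intro!: continuous_intros)

lemma Ck_on_mult:
  fixes f g :: "'a::real_normed_vector \<Rightarrow> real"
  assumes "open S" "Ck_on k S f" "Ck_on k S g"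
  shows "Ck_on k S (\<lambda>x. f x * g x)"
  using Ck_on_scaleR[OF assms] by simp

lemma Ck_on_sum:
  assumes "open S" "\<And>i. i \<in> I \<Longrightarrow> Ck_on k S (f i)"
  shows "Ck_on k S (\<lambda>x. \<Sum>i\<in>I. f i x)"
  using assms(2)
  by (induction I rule: infinite_finite_induct) (auto intro!: Ck_on_const Ck_on_add assms(1))

lemma Ck_on_prod:
  fixes f :: "'i \<Rightarrow> 'a::real_normed_vector \<Rightarrow> real"
  assumes "open S" "\<And>i. i \<in> I \<Longrightarrow> Ck_on k S (f i)"
  shows "Ck_on k S (\<lambda>x. \<Prod>i\<in>I. f i x)"
  using assms(2)
  by (induction I rule: infinite_finite_induct) (auto intro!: Ck_on_const Ck_on_mult assms(1))

lemma Ck_on_bounded_linear_compose: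
  assumes "open S" "bounded_linear L" "Ck_on k S f"
  shows "Ck_on k S (\<lambda>x. L (f x))"
  using assms(3)
proof (induction k arbitrary: f)
  case 0
  then show ?case
    using bounded_linear.continuous_on[OF assms(2)] by simp
next
  case (Suc k)
  then show ?case
    by (intro Ck_on_SucI[OF assms(1)
          bounded_linear.has_derivative[OF assms(2) Ck_on_has_derivative[OF Suc.prems]]] Suc.IH) auto
qed

lemma Ck_on_bounded_linear:
  assumes "open S" "bounded_linear L"
  shows "Ck_on k S L"
proof (cases k)
  case 0
  then show ?thesis
    using bounded_linear.continuous_on[OF assms(2) continuous_on_id] by simp
next
  case (Suc k')
  show ?thesis
    unfolding Suc by (intro Ck_on_SucI[OF assms(1), where D = "\<lambda>x. L"]
      bounded_linear_imp_has_derivative Ck_on_const assms)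
qed

lemma Ck_on_compose:
  fixes g :: "'a::real_normed_vector \<Rightarrow> 'b::euclidean_space" and f :: "'b \<Rightarrow> 'c::real_normed_vector"
  assumes "open S" "Ck_on k S g" "Ck_on k T f" "g ` S \<subseteq> T"
  shows "Ck_on k S (\<lambda>x. f (g x))"
  using assms(2,3)
proof (induction k arbitrary: f)
  case 0
  then show ?case using assms(4) by (auto intro: continuous_on_compose2)
next
  case (Suc k)
  \<comment> \<open>The direction in which \<open>f\<close> is differentiated depends on
    \<open>x\<close> through the derivative of \<open>g\<close>. Expanding it in the basis leaves
    fixed directions \<open>b\<close>, to which the induction hypothesis applies.\<close>
  define D where "D x v = (\<Sum>b\<in>Basis. (frechet_derivative g (at x) v \<bullet> b) *\<^sub>R
    frechet_derivative f (at (g x)) b)" for x v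
  show ?case
  proof (rule Ck_on_SucI[OF assms(1)])
    fix x assume x: "x \<in> S"
    then have f: "(f has_derivative frechet_derivative f (at (g x))) (at (g x))"
      using Ck_on_has_derivative[OF Suc.prems(2)] assms(4) by auto
    interpret bounded_linear "frechet_derivative f (at (g x))"
      using f by (rule has_derivative_bounded_linear)
    have rep: "frechet_derivative f (at (g x)) u =
      (\<Sum>b\<in>Basis. (u \<bullet> b) *\<^sub>R frechet_derivative f (at (g x)) b)" for u
      by (subst euclidean_representation[of u, symmetric]) (simp only: sum scaleR)
    have "D x = (\<lambda>v. frechet_derivative f (at (g x)) (frechet_derivative g (at x) v))"
      unfolding D_def by (rule ext) (rule rep[symmetric])
    then show "((\<lambda>x. f (g x)) has_derivative D x) (at x)"
      using has_derivative_compose[OF Ck_on_has_derivative[OF Suc.prems(1) x] f] by simp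
  next
    fix v
    have "Ck_on k S (\<lambda>x. frechet_derivative f (at (g x)) b)" for b
      by (rule Suc.IH[OF Ck_on_SucD[OF Suc.prems(1)]]) (use Suc.prems(2) in simp)
    moreover have "Ck_on k S (\<lambda>x. frechet_derivative g (at x) v \<bullet> b)" for b
      by (rule Ck_on_bounded_linear_compose[OF assms(1) bounded_linear_inner_left])
        (use Suc.prems(1) in simp)
    ultimately show "Ck_on k S (\<lambda>x. D x v)"
      unfolding D_def by (intro Ck_on_sum Ck_on_scaleR assms(1))
  qed
qed

lemma Ck_on_vec:
  fixes f :: "'a::real_normed_vector \<Rightarrow> real^'n"
  assumes "open S" "\<And>i. Ck_on k S (\<lambda>x. f x $ i)"
  shows "Ck_on k S f"
proof -
  have "Ck_on k S (\<lambda>x. \<Sum>i\<in>UNIV. (f x $ i) *\<^sub>R axis i 1)"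
    by (intro Ck_on_sum Ck_on_scaleR Ck_on_const assms)
  then show ?thesis
    by (rule Ck_on_cong[OF assms(1)]) (metis basis_expansion scalar_mult_eq_scaleR)
qed

section \<open>Elementary functions on their domains of smoothness\<close>

lemma Ck_on_exp: "open S \<Longrightarrow> Ck_on k S (exp :: real \<Rightarrow> real)"
proof (induction k)
  case (Suc k)
  then show ?case
    by (intro Ck_on_SucI[where D = "\<lambda>x v. v * exp x"] Ck_on_mult Ck_on_const)
      (auto intro!: derivative_eq_intros)
qed (auto intro!: continuous_intros)

lemma Ck_on_inverse: "Ck_on k (- {0}) (inverse :: real \<Rightarrow> real)"
proof (induction k)
  case (Suc k)
  show ?case
    by (intro Ck_on_SucI[where D = "\<lambda>x v. (- v) * (inverse x * inverse x)"] Ck_on_mult Ck_on_const Suc.IH)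
      (auto intro!: derivative_eq_intros)
qed (auto intro!: continuous_intros)

lemma Ck_on_ln: "Ck_on k {0<..} (ln :: real \<Rightarrow> real)"
proof (cases k)
  case (Suc k)
  have "Ck_on k {0<..} (\<lambda>x::real. inverse x)"
    by (rule Ck_on_compose[OF _ Ck_on_bounded_linear Ck_on_inverse]) auto
  then show ?thesis unfolding Suc
    by (intro Ck_on_SucI[where D = "\<lambda>x v. v * inverse x"] Ck_on_mult Ck_on_const)
      (auto intro!: derivative_eq_intros)
qed (auto intro!: continuous_intros)

lemma Ck_on_divide:
  fixes f g :: "'a::real_normed_vector \<Rightarrow> real"
  assumes "open S" "Ck_on k S f" "Ck_on k S g" "\<And>x. x \<in> S \<Longrightarrow> g x \<noteq> 0"
  shows "Ck_on k S (\<lambda>x. f x / g x)"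
proof -
  have "Ck_on k S (\<lambda>x. inverse (g x))"
    by (rule Ck_on_compose[OF assms(1,3) Ck_on_inverse]) (use assms(4) in auto)
  then show ?thesis unfolding divide_inverse by (rule Ck_on_mult[OF assms(1,2)])
qed

lemma Ck_on_diff:
  fixes f g :: "'a::real_normed_vector \<Rightarrow> 'b::real_normed_vector"
  assumes "open S" "Ck_on k S f" "Ck_on k S g"
  shows "Ck_on k S (\<lambda>x. f x - g x)"
  using Ck_on_add[OF assms(1,2) Ck_on_scaleR[OF assms(1) Ck_on_const[OF assms(1), where c = "-1"] assms(3)]]
  by simp

lemma Ck_on_ln_compose:
  assumes "open S" "Ck_on k S f" "\<And>x. x \<in> S \<Longrightarrow> f x > (0::real)"
  shows "Ck_on k S (\<lambda>x. ln (f x))"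
  by (rule Ck_on_compose[OF assms(1,2) Ck_on_ln]) (use assms(3) in auto)

lemma Ck_on_exp_compose:
  assumes "open S" "Ck_on k S f"
  shows "Ck_on k S (\<lambda>x. exp (f x :: real))"
  by (rule Ck_on_compose[OF assms Ck_on_exp[OF open_UNIV]]) auto

lemma Ck_on_sqrt_compose:
  assumes "open S" "Ck_on k S f" "\<And>x. x \<in> S \<Longrightarrow> f x > (0::real)"
  shows "Ck_on k S (\<lambda>x. sqrt (f x))"
proof -
  have "Ck_on k S (\<lambda>x. exp (ln (f x) * (1 / 2)))"
    by (intro Ck_on_exp_compose Ck_on_mult Ck_on_ln_compose Ck_on_const assms)
  then show ?thesis
    by (rule Ck_on_cong[OF assms(1)])
      (use assms(3) in \<open>auto simp: powr_half_sqrt[symmetric] powr_def less_imp_le less_imp_neq[symmetric]\<close>)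
qed

lemma Ck_on_arcosh_compose:
  assumes "open S" "Ck_on k S f" "\<And>x. x \<in> S \<Longrightarrow> f x > (1::real)"
  shows "Ck_on k S (\<lambda>x. arcosh (f x))"
proof -
  have pos: "f x * f x - 1 > 0" if "x \<in> S" for x
    using assms(3)[OF that] less_1_mult[of "f x" "f x"] by simp
  have "Ck_on k S (\<lambda>x. ln (f x + sqrt (f x * f x - 1)))"
  proof (intro Ck_on_ln_compose Ck_on_add Ck_on_sqrt_compose Ck_on_diff Ck_on_mult Ck_on_const assms(1,2))
    show "f x + sqrt (f x * f x - 1) > 0" if "x \<in> S" for x
      using pos[OF that] assms(3)[OF that] by (intro add_pos_pos) auto
  qed (rule pos)
  then show ?thesis
    by (rule Ck_on_cong[OF assms(1)])
      (use assms(3) in \<open>auto simp: arcosh_real_def power2_eq_square less_imp_le\<close>)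
qed

section \<open>Smoothness of the inverse of an injective map\<close>

lemma Ck_on_det:
  fixes A :: "'a::real_normed_vector \<Rightarrow> real^'n^'n"
  assumes "open S" "\<And>i j. Ck_on k S (\<lambda>x. A x $ i $ j)"
  shows "Ck_on k S (\<lambda>x. det (A x))"
  unfolding det_def by (intro Ck_on_sum Ck_on_mult Ck_on_const Ck_on_prod assms)

text \<open>Injectivity provides a global inverse, and invariance of domain makes it continuous on
  an open image. It is differentiable because the derivative of \<open>f\<close> is invertible, and
  it is smooth by bootstrapping: its derivative is a smooth function of the inverse itself.\<close>

theorem smooth_on_inv_into:
  fixes f :: "real^'n \<Rightarrow> real^'n"
  assumes S: "open S" and inj: "inj_on f S" and smooth: "smooth_on S f"
    and D: "\<And>x v. x \<in> S \<Longrightarrow> frechet_derivative f (at x) v = 0 \<Longrightarrow> v = 0"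
  shows "smooth_on (f ` S) (inv_into S f)"
proof -
  define g where "g = inv_into S f"
  have Ck: "Ck_on k S f" for k using smooth by (simp add: smooth_on_def)
  have cont: "continuous_on S f" using Ck[of 0] by simp
  have T: "open (f ` S)" using invariance_of_domain[OF cont S inj] .
  have contg: "continuous_on (f ` S) g"
    unfolding g_def using continuous_on_inverse_open[OF S cont _ ] inj by auto
  have gS: "g ` f ` S \<subseteq> S" unfolding g_def by (auto intro: inv_into_into)
  have fg: "f (g y) = y" if "y \<in> f ` S" for y using that unfolding g_def by (rule f_inv_into_f)
  define J where "J x = matrix (frechet_derivative f (at x))" for x
  \<comment> \<open>By Cramer's rule \<open>H v x\<close> is the solution \<open>u\<close> of
    \<open>J x *v u = v\<close>. It is rational in the entries of \<open>J x\<close>, hence as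
    smooth in \<open>x\<close> as they are.\<close>
  define H where "H v x = (\<chi> k. det (\<chi> i j. if j = k then v $ i else J x $ i $ j) / det (J x))" for v x
  have der: "(f has_derivative frechet_derivative f (at x)) (at x)" if "x \<in> S" for x
    using Ck_on_has_derivative[OF Ck that] .
  have J: "J x *v v = frechet_derivative f (at x) v" if "x \<in> S" for x v
    unfolding J_def using has_derivative_linear[OF der[OF that]]
    by (intro matrix_works) (simp add: linear_matrix_vector_mul_eq)
  have detJ: "det (J x) \<noteq> 0" if "x \<in> S" for x
  proof -
    have "\<exists>B. B ** J x = mat 1"
      unfolding matrix_left_invertible_ker using D[OF that] J[OF that] by auto
    then show ?thesis by (simp add: invertible_left_inverse invertible_det_nz[symmetric])
  qed
  have HJ: "H (frechet_derivative f (at x) v) x = v" if "x \<in> S" for x v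
    using cramer[OF detJ[OF that]] J[OF that] unfolding H_def by metis
  have linH: "linear (\<lambda>v. H v x)" if "x \<in> S" for x
  proof -
    have JH: "J x *v (H v x) = v" for v
      using cramer[OF detJ[OF that]] unfolding H_def by metis
    have "H (J x *v u) x = u" for u using HJ[OF that] J[OF that] by metis
    then show ?thesis
      by (intro linearI) (metis JH matrix_vector_right_distrib, metis JH matrix_vector_mult_scaleR)
  qed
  have derg: "(g has_derivative (\<lambda>v. H v (g y))) (at y)" if y: "y \<in> f ` S" for y
  proof (rule has_derivative_inverse_basic[OF der _ _ _ T y fg])
    show "g y \<in> S" using gS y by auto
    then show "bounded_linear (\<lambda>v. H v (g y))" using linH by (simp add: linear_conv_bounded_linear)
    show "(\<lambda>v. H v (g y)) \<circ> frechet_derivative f (at (g y)) = id"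
      using HJ[OF \<open>g y \<in> S\<close>] by auto
    show "continuous (at y) g" using contg T y continuous_on_eq_continuous_at by blast
  qed auto
  have "Ck_on k S (\<lambda>x. frechet_derivative f (at x) v)" for k v
    using Ck[of "Suc k"] by simp
  then have CJ: "Ck_on k S (\<lambda>x. J x $ i $ j)" for k i j
    unfolding J_def matrix_def
    by (simp add: Ck_on_bounded_linear_compose[OF S bounded_linear_vec_nth])
  have CH: "Ck_on k S (H v)" for k v
  proof (rule Ck_on_vec[OF S])
    fix m
    have "Ck_on k S (\<lambda>x. if j = m then v $ i else J x $ i $ j)" for i j
      by (cases "j = m") (simp_all add: Ck_on_const S CJ)
    then show "Ck_on k S (\<lambda>x. H v x $ m)"
      unfolding H_def by (simp add: Ck_on_divide Ck_on_det S CJ detJ)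
  qed
  have "Ck_on k (f ` S) g" for k
  proof (induction k)
    case (Suc k)
    then show ?case
      using derg by (intro Ck_on_SucI[OF T, where D = "\<lambda>y v. H v (g y)"] Ck_on_compose[OF T _ CH gS]) auto
  qed (simp add: contg)
  then show ?thesis by (simp add: smooth_on_def g_def)
qed

section \<open>Right-angled hexagons\<close>

text \<open>The hexagon law of cosines for the B-arc opposite the edge with hyperbolic cosine
  \<open>x\<close>; \<open>y\<close> and \<open>z\<close> belong to the adjacent edges, whose
  hyperbolic sines are written as roots.\<close>

definition hex_ratio :: "real \<Rightarrow> real \<Rightarrow> real \<Rightarrow> real" where
  "hex_ratio x y z = (x + y * z) / (sqrt (y\<^sup>2 - 1) * sqrt (z\<^sup>2 - 1))"

text \<open>In the numerator, \<open>x\<close> is dropped and one adjacent hyperbolic cosine is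
  replaced by the smaller hyperbolic sine, which cancels. What is left is the hyperbolic cotangent
  of the other adjacent edge, which blows up as that edge shrinks.\<close>

lemma hex_ratio_gt_coth:
  assumes "x > 1" "y > 1" "z > 1"
  shows "hex_ratio x y z > y / sqrt (y\<^sup>2 - 1)" "hex_ratio x y z > z / sqrt (z\<^sup>2 - 1)"
proof -
  have s: "sqrt (u\<^sup>2 - 1) > 0" "sqrt (u\<^sup>2 - 1) < u" if "u > 1" for u :: real
  proof -
    show "sqrt (u\<^sup>2 - 1) > 0" using that by (simp add: power2_eq_square less_1_mult)
    have "sqrt (u\<^sup>2 - 1) < sqrt (u\<^sup>2)" by (rule real_sqrt_less_mono) simp
    then show "sqrt (u\<^sup>2 - 1) < u" using that by simp
  qed
  have *: "(x + u * v) / (sqrt (u\<^sup>2 - 1) * sqrt (v\<^sup>2 - 1)) > u / sqrt (u\<^sup>2 - 1)"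
    if "u > 1" "v > 1" for u v
  proof -
    have "u * sqrt (v\<^sup>2 - 1) < x + u * v"
      using mult_strict_left_mono[OF s(2)[OF that(2)], of u] that assms(1) by linarith
    then show ?thesis using s(1)[OF that(1)] s(1)[OF that(2)] by (simp add: divide_simps mult_ac)
  qed
  show "hex_ratio x y z > y / sqrt (y\<^sup>2 - 1)" "hex_ratio x y z > z / sqrt (z\<^sup>2 - 1)"
    using *[OF assms(2,3)] *[OF assms(3,2)] by (simp_all add: hex_ratio_def mult.commute)
qed

lemma hex_ratio_gt_1:
  assumes "x > 1" "y > 1" "z > 1"
  shows "hex_ratio x y z > 1"
proof -
  have "y / sqrt (y\<^sup>2 - 1) \<ge> 1"
  proof -
    have "sqrt (y\<^sup>2 - 1) \<le> sqrt (y\<^sup>2)" by (rule real_sqrt_le_mono) simp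
    moreover have "y\<^sup>2 > 1" using assms(2) by (simp add: power2_eq_square less_1_mult)
    ultimately show ?thesis using assms(2) by (simp add: le_divide_eq)
  qed
  then show ?thesis using hex_ratio_gt_coth(1)[OF assms] by linarith
qed

text \<open>This equals \<open>(x + y * z)\<^sup>2 - (y\<^sup>2 - 1) * (z\<^sup>2 - 1)\<close>, the
  numerator of \<open>(hex_ratio x y z)\<^sup>2 - 1\<close>. It is symmetric, so the three arcs of a
  hexagon share it.\<close>

definition hex_disc :: "real \<Rightarrow> real \<Rightarrow> real \<Rightarrow> real" where
  "hex_disc x y z = x\<^sup>2 + y\<^sup>2 + z\<^sup>2 + 2 * (x * y * z) - 1"

lemma hex_disc_pos:
  assumes "x > 1" "y > 1" "z > 1"
  shows "hex_disc x y z > 0"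
proof -
  have "x\<^sup>2 > 1" using assms by (simp add: power2_eq_square less_1_mult)
  moreover have "x * y * z > 0" using assms by simp
  moreover have "y\<^sup>2 \<ge> 0" "z\<^sup>2 \<ge> 0" by simp_all
  ultimately show ?thesis unfolding hex_disc_def by linarith
qed

text \<open>Up to the factor \<open>2 / sqrt (hex_disc x y z)\<close>, the rate of change of the B-arc when the conformal
  factors on the edges with hyperbolic cosines \<open>x, y, z\<close> grow at rates \<open>a, b, c\<close>.\<close>

definition arc_rate :: "real \<Rightarrow> real \<Rightarrow> real \<Rightarrow> real \<Rightarrow> real \<Rightarrow> real \<Rightarrow> real" where
  "arc_rate x y z a b c = (x + 1) * a - (z + x * y) / (y - 1) * b - (y + x * z) / (z - 1) * c"

text \<open>The assumed rates come from \<open>x + 1 = 2 * (cosh (l / 2))\<^sup>2\<close>, which a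
  conformal change multiplies by the exponential of twice the edge sum.\<close>

lemma arcosh_hex_ratio_deriv:
  fixes x y z :: "real \<Rightarrow> real"
  assumes gt: "x t > 1" "y t > 1" "z t > 1"
    and dx: "(x has_real_derivative 2 * (x t + 1) * a) (at t)"
    and dy: "(y has_real_derivative 2 * (y t + 1) * b) (at t)"
    and dz: "(z has_real_derivative 2 * (z t + 1) * c) (at t)"
  shows "((\<lambda>t. arcosh (hex_ratio (x t) (y t) (z t))) has_real_derivative
     2 * arc_rate (x t) (y t) (z t) a b c / sqrt (hex_disc (x t) (y t) (z t))) (at t)"
proof -
  define X Y Z where "X = x t" "Y = y t" "Z = z t"
  define A where "A = sqrt (Y\<^sup>2 - 1)"
  define B where "B = sqrt (Z\<^sup>2 - 1)"
  define D where "D = sqrt (hex_disc X Y Z)"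
  have XYZ: "X > 1" "Y > 1" "Z > 1" using gt by (simp_all add: X_Y_Z_def)
  have Y2: "Y\<^sup>2 - 1 > 0" and Z2: "Z\<^sup>2 - 1 > 0"
    using XYZ by (simp_all add: power2_eq_square less_1_mult)
  have A: "A > 0" "A\<^sup>2 = Y\<^sup>2 - 1" and B: "B > 0" "B\<^sup>2 = Z\<^sup>2 - 1"
    using Y2 Z2 by (simp_all add: A_def B_def)
  have D: "D > 0" "D\<^sup>2 = hex_disc X Y Z"
    using hex_disc_pos[OF XYZ] by (simp_all add: D_def)
  define R where "R = (X + Y * Z) / (A * B)"
  have R: "R = hex_ratio X Y Z" by (simp add: R_def hex_ratio_def A_def B_def)
  have R1: "R > 1" unfolding R using hex_ratio_gt_1[OF XYZ] .
  \<comment> \<open>This identifies the hyperbolic sine of the arc as \<open>D / (A * B)\<close>;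
    its \<open>A * B\<close> cancels against the denominator left by the quotient rule.\<close>
  have "R\<^sup>2 - 1 = (D / (A * B))\<^sup>2"
  proof -
    have "(A * B)\<^sup>2 = (Y\<^sup>2 - 1) * (Z\<^sup>2 - 1)" using A B by (simp add: power_mult_distrib)
    moreover have "(X + Y * Z)\<^sup>2 - (Y\<^sup>2 - 1) * (Z\<^sup>2 - 1) = D\<^sup>2"
      unfolding D(2) hex_disc_def by (simp add: power2_eq_square algebra_simps)
    ultimately have "(X + Y * Z)\<^sup>2 = (A * B)\<^sup>2 + D\<^sup>2" by linarith
    moreover have "(A * B)\<^sup>2 \<noteq> 0" using A B by simp
    ultimately show ?thesis unfolding R_def power_divide by (simp only: add_divide_distrib) simp
  qed
  then have sq: "sqrt (R\<^sup>2 - 1) = D / (A * B)" using A B D by simp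
  have dA: "((\<lambda>t. sqrt ((y t)\<^sup>2 - 1)) has_real_derivative 2 * (Y + 1) * b * Y / A) (at t)"
    using Y2 by (auto intro!: derivative_eq_intros dy simp: X_Y_Z_def A_def field_simps)
  have dB: "((\<lambda>t. sqrt ((z t)\<^sup>2 - 1)) has_real_derivative 2 * (Z + 1) * c * Z / B) (at t)"
    using Z2 by (auto intro!: derivative_eq_intros dz simp: X_Y_Z_def B_def field_simps)
  define N where "N = 2 * (X + 1) * a + (2 * (Y + 1) * b * Z + 2 * (Z + 1) * c * Y)"
  have dN: "((\<lambda>t. x t + y t * z t) has_real_derivative N) (at t)"
    unfolding N_def X_Y_Z_def by (intro derivative_intros dx dy dz)
  have dM: "((\<lambda>t. sqrt ((y t)\<^sup>2 - 1) * sqrt ((z t)\<^sup>2 - 1)) has_real_derivative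
      (2 * (Y + 1) * b * Y / A) * B + (2 * (Z + 1) * c * Z / B) * A) (at t)" (is "(_ has_real_derivative ?M) _")
    using DERIV_mult[OF dA dB] by (simp add: X_Y_Z_def A_def B_def mult.commute)
  have "((\<lambda>t. hex_ratio (x t) (y t) (z t)) has_real_derivative
      (N * (A * B) - (X + Y * Z) * ?M) / ((A * B) * (A * B))) (at t)"
    unfolding hex_ratio_def
    using DERIV_divide[OF dN dM] A B by (simp add: X_Y_Z_def A_def B_def)
  moreover have "(arcosh has_real_derivative 1 / sqrt (R\<^sup>2 - 1)) (at (hex_ratio (x t) (y t) (z t)))"
    using arcosh_real_has_field_derivative[OF R1] by (simp add: R X_Y_Z_def)
  ultimately have "((\<lambda>t. arcosh (hex_ratio (x t) (y t) (z t))) has_real_derivative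
      1 / sqrt (R\<^sup>2 - 1) * ((N * (A * B) - (X + Y * Z) * ?M) / ((A * B) * (A * B)))) (at t)"
    by (rule DERIV_chain2[rotated])
  moreover have "1 / sqrt (R\<^sup>2 - 1) * ((N * (A * B) - (X + Y * Z) * ?M) / ((A * B) * (A * B)))
    = 2 * arc_rate X Y Z a b c / D"
  proof -
    \<comment> \<open>Since \<open>A\<^sup>2 = (Y - 1) * (Y + 1)\<close>, the quotient
      \<open>(Y + 1) / A\<close> is \<open>A / (Y - 1)\<close>; the same holds for \<open>B\<close>,
      so \<open>A * B\<close> factors out.\<close>
    have M: "?M = A * B * (2 * b * Y / (Y - 1) + 2 * c * Z / (Z - 1))"
    proof -
      have *: "2 * (u + 1) * e * u / k = k * (2 * e * u / (u - 1))"
        if "k > 0" "k\<^sup>2 = u\<^sup>2 - 1" "u > 1" for u e k :: real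
      proof -
        have "2 * (u + 1) * e * u * (u - 1) = k\<^sup>2 * (2 * e * u)"
          unfolding that(2) by (simp add: power2_eq_square algebra_simps)
        then show ?thesis using that(1,3) by (simp add: divide_eq_eq eq_divide_eq power2_eq_square mult_ac)
      qed
      have "2 * (Y + 1) * b * Y / A = A * (2 * b * Y / (Y - 1))"
        by (rule *[OF A XYZ(2)])
      moreover have "2 * (Z + 1) * c * Z / B = B * (2 * c * Z / (Z - 1))"
        by (rule *[OF B XYZ(3)])
      ultimately show ?thesis by (simp add: algebra_simps)
    qed
    have e: "N - (X + Y * Z) * (2 * b * Y / (Y - 1) + 2 * c * Z / (Z - 1)) = 2 * arc_rate X Y Z a b c"
    proof -
      have *: "2 * (u + 1) * e * v - (X + u * v) * (2 * e * u / (u - 1)) = - (2 * ((v + X * u) / (u - 1) * e))"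
        if "u > 1" for u v e :: real
        using that by (simp add: field_simps)
      have "N - (X + Y * Z) * (2 * b * Y / (Y - 1) + 2 * c * Z / (Z - 1)) = 2 * (X + 1) * a
        + (2 * (Y + 1) * b * Z - (X + Y * Z) * (2 * b * Y / (Y - 1)))
        + (2 * (Z + 1) * c * Y - (X + Z * Y) * (2 * c * Z / (Z - 1)))"
        unfolding N_def by (simp add: algebra_simps)
      then show ?thesis unfolding *[OF XYZ(2)] *[OF XYZ(3)] arc_rate_def by (simp add: algebra_simps)
    qed
    have "N * k - n * (k * m) = k * (N - n * m)" for k n m by (simp add: algebra_simps)
    from this[of "A * B" "X + Y * Z" "2 * b * Y / (Y - 1) + 2 * c * Z / (Z - 1)"]
    have "(N * (A * B) - (X + Y * Z) * ?M) = A * B * (2 * arc_rate X Y Z a b c)"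
      unfolding M e .
    then show ?thesis unfolding sq using A B D by simp
  qed
  ultimately show ?thesis by (simp add: X_Y_Z_def D_def)
qed

text \<open>With \<open>p = x - 1\<close> etc. and \<open>P = p + q + r + 2\<close>, the form is minus
  \<open>(P/p) (v + w)\<^sup>2 + (P/q) (u + w)\<^sup>2 + (P/r) (u + v)\<^sup>2 + 2 (p u\<^sup>2 + q v\<^sup>2 + r w\<^sup>2) - 4 (u v + v w + w u)\<close>,
  and \<open>4 u v \<le> (u + v)\<^sup>2\<close> while \<open>P > p, q, r\<close>.\<close>

lemma arc_rate_form:
  fixes x y z u v w :: real
  assumes "x > 1" "y > 1" "z > 1"
  defines "s \<equiv> u * arc_rate x y z (v + w) (w + u) (u + v) + v * arc_rate y z x (w + u) (u + v) (v + w)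
    + w * arc_rate z x y (u + v) (v + w) (w + u)"
  shows "s \<le> 0" and "u \<noteq> 0 \<or> v \<noteq> 0 \<or> w \<noteq> 0 \<Longrightarrow> s < 0"
proof -
  define p q r where "p = x - 1" "q = y - 1" "r = z - 1"
  have pos: "p > 0" "q > 0" "r > 0" using assms by (simp_all add: p_q_r_def)
  have xyz: "x = p + 1" "y = q + 1" "z = r + 1" by (simp_all add: p_q_r_def)
  define P where "P = p + q + r + 2"
  have "s = - (P / p * (v + w)\<^sup>2 + P / q * (w + u)\<^sup>2 + P / r * (u + v)\<^sup>2
     + 2 * (p * u\<^sup>2 + q * v\<^sup>2 + r * w\<^sup>2) - 4 * (u * v + v * w + w * u))"
  proof -
    \<comment> \<open>In the shifted variables \<open>z + x * y = P + p * q\<close>, and similarly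
      for the other numerators, so every quotient splits into one of \<open>A\<close>,
      \<open>B\<close>, \<open>C\<close> plus a variable. With these three as atoms the identity is
      polynomial.\<close>
    define A B C where "A = P / p" "B = P / q" "C = P / r"
    have "(z + x * y) / (y - 1) = B + p" "(y + x * z) / (z - 1) = C + p"
      "(x + y * z) / (z - 1) = C + q" "(z + y * x) / (x - 1) = A + q"
      "(y + z * x) / (x - 1) = A + r" "(x + z * y) / (y - 1) = B + r"
      using pos unfolding xyz A_B_C_def P_def by (simp_all add: field_simps)
    then have "s = u * ((x + 1) * (v + w) - (B + p) * (w + u) - (C + p) * (u + v))
      + v * ((y + 1) * (w + u) - (C + q) * (u + v) - (A + q) * (v + w))
      + w * ((z + 1) * (u + v) - (A + r) * (v + w) - (B + r) * (w + u))"
      unfolding s_def arc_rate_def by simp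
    then show ?thesis unfolding A_B_C_def[symmetric] xyz
      by (simp add: power2_eq_square algebra_simps)
  qed
  moreover have "P / p * (v + w)\<^sup>2 \<ge> 4 * (v * w)" "P / q * (w + u)\<^sup>2 \<ge> 4 * (w * u)"
    "P / r * (u + v)\<^sup>2 \<ge> 4 * (u * v)"
  proof -
    have *: "c * (m + n)\<^sup>2 \<ge> 4 * (m * n)" if "c \<ge> 1" for c m n :: real
    proof -
      have "4 * (m * n) \<le> (m + n)\<^sup>2"
        using zero_le_power2[of "m - n"] by (simp add: power2_eq_square algebra_simps)
      also have "\<dots> \<le> c * (m + n)\<^sup>2" using mult_right_mono[OF that, of "(m + n)\<^sup>2"] by simp
      finally show ?thesis .
    qed
    show "P / p * (v + w)\<^sup>2 \<ge> 4 * (v * w)" "P / q * (w + u)\<^sup>2 \<ge> 4 * (w * u)"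
      "P / r * (u + v)\<^sup>2 \<ge> 4 * (u * v)"
      by (rule *; use pos in \<open>simp add: P_def\<close>)+
  qed
  ultimately have le: "s \<le> - (2 * (p * u\<^sup>2) + 2 * (q * v\<^sup>2) + 2 * (r * w\<^sup>2))"
    by (simp add: algebra_simps)
  have "p * u\<^sup>2 \<ge> 0" "q * v\<^sup>2 \<ge> 0" "r * w\<^sup>2 \<ge> 0" using pos by simp_all
  then show "s \<le> 0" using le by linarith
  show "s < 0" if "u \<noteq> 0 \<or> v \<noteq> 0 \<or> w \<noteq> 0"
  proof -
    have "p * u\<^sup>2 > 0 \<or> q * v\<^sup>2 > 0 \<or> r * w\<^sup>2 > 0" using that pos by auto
    then show ?thesis
      using le \<open>p * u\<^sup>2 \<ge> 0\<close> \<open>q * v\<^sup>2 \<ge> 0\<close> \<open>r * w\<^sup>2 \<ge> 0\<close> by linarith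
  qed
qed

text \<open>Here \<open>a\<close>, \<open>b\<close>, \<open>c\<close> stand for squared hyperbolic
  cosines of half edge lengths, so \<open>2 * a - 1\<close> is the hyperbolic cosine of the edge.
  The numerator is at least \<open>a\<close> and the roots are at most \<open>2 * b\<close> and
  \<open>2 * c\<close>.\<close>

lemma hex_ratio_ge:
  assumes "a > 1" "b > 1" "c > 1"
  shows "hex_ratio (2 * a - 1) (2 * b - 1) (2 * c - 1) \<ge> a / (4 * (b * c))"
proof -
  have s: "sqrt ((2 * u - 1)\<^sup>2 - 1) \<le> 2 * u" "sqrt ((2 * u - 1)\<^sup>2 - 1) > 0" if "u > 1" for u :: real
  proof -
    have "sqrt ((2 * u - 1)\<^sup>2 - 1) \<le> sqrt ((2 * u - 1)\<^sup>2)" by (rule real_sqrt_le_mono) simp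
    then show "sqrt ((2 * u - 1)\<^sup>2 - 1) \<le> 2 * u" using that by simp
    have "1 < (2 * u - 1)\<^sup>2" using that by (intro one_less_power) auto
    then show "sqrt ((2 * u - 1)\<^sup>2 - 1) > 0" by simp
  qed
  have "sqrt ((2 * b - 1)\<^sup>2 - 1) * sqrt ((2 * c - 1)\<^sup>2 - 1) \<le> (2 * b) * (2 * c)"
    using s assms by (intro mult_mono) (auto simp: less_imp_le)
  moreover have "sqrt ((2 * b - 1)\<^sup>2 - 1) * sqrt ((2 * c - 1)\<^sup>2 - 1) > 0" using s assms by simp
  moreover have "a \<le> 2 * a - 1 + (2 * b - 1) * (2 * c - 1)"
    using assms mult_pos_pos[of "2 * b - 1" "2 * c - 1"] by linarith
  ultimately show ?thesis unfolding hex_ratio_def using assms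
    by (intro frac_le) auto
qed

text \<open>The fraction splits into a multiple of \<open>2 * a - 1\<close> and a product of two
  hyperbolic cotangents that is close to 1 for long edges. So the arc is short once both adjacent
  edges are long and \<open>a / (b * c)\<close> is small.\<close>

lemma hex_ratio_le:
  assumes "a > 1" "b \<ge> Q" "c \<ge> Q" "Q \<ge> 2"
  shows "hex_ratio (2 * a - 1) (2 * b - 1) (2 * c - 1) \<le> 2 * (a / (b * c)) + (1 + 1 / Q)\<^sup>2"
proof -
  define S where "S u = sqrt ((2 * u - 1)\<^sup>2 - 1)" for u :: real
  have S: "S u \<ge> u" "(2 * u - 1) / S u \<le> 1 + 1 / Q" if "u \<ge> Q" for u
  proof -
    have u: "u \<ge> 2" using that assms by simp
    have "(2 * u - 2)\<^sup>2 \<le> (2 * u - 1)\<^sup>2 - 1" using u by (simp add: power2_eq_square algebra_simps)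
    then have *: "S u \<ge> 2 * u - 2" unfolding S_def by (intro real_le_rsqrt) 
    then show "S u \<ge> u" using u by simp
    have "(2 * u - 1) / S u \<le> (2 * u - 1) / (2 * u - 2)" using * u by (intro divide_left_mono mult_pos_pos) auto
    also have "\<dots> = 1 + 1 / (2 * u - 2)" using u by (simp add: field_simps)
    also have "\<dots> \<le> 1 + 1 / Q" using that u assms by (intro add_left_mono divide_left_mono) auto
    finally show "(2 * u - 1) / S u \<le> 1 + 1 / Q" .
  qed
  have pos: "b > 0" "c > 0" "S b > 0" "S c > 0" using S[OF assms(2)] S[OF assms(3)] assms by linarith+
  have "hex_ratio (2 * a - 1) (2 * b - 1) (2 * c - 1)
    = (2 * a - 1) / (S b * S c) + (2 * b - 1) / S b * ((2 * c - 1) / S c)"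
    unfolding hex_ratio_def S_def by (simp add: add_divide_distrib)
  also have "(2 * a - 1) / (S b * S c) \<le> (2 * a) / (b * c)"
    using pos assms S[OF assms(2)] S[OF assms(3)] by (intro frac_le mult_mono) auto
  also have "(2 * b - 1) / S b * ((2 * c - 1) / S c) \<le> (1 + 1 / Q) * (1 + 1 / Q)"
    using pos assms S[OF assms(2)] S[OF assms(3)] by (intro mult_mono) auto
  finally show ?thesis by (simp add: power2_eq_square)
qed

section \<open>The boundary length map\<close>

lemma nx_simps [simp]:
  "nx (Suc 0) 0 = 1" "nx (Suc 0) (Suc 0) = 2" "nx (Suc 0) 2 = 0" "nx 2 0 = 2" "nx 2 (Suc 0) = 0" "nx 2 2 = 1"
  by (simp_all add: nx_def)

lemma nx_mem: "nx k c = 0 \<or> nx k c = Suc 0 \<or> nx k c = 2"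
  unfolding nx_def by (metis less_2_cases_iff mod_less_divisor less_Suc_eq numeral_3_eq_3 numeral_2_eq_2 zero_less_Suc One_nat_def)

lemma nx_sides: "s \<in> sides F \<Longrightarrow> (fst s, nx k c) \<in> sides F"
  using nx_mem[of k c] by (auto simp: sides_def)

lemma corners_eq_sides: "corners F = sides F"
  by (simp add: corners_def sides_def)

lemma sum_corners:
  fixes g :: "'f \<times> nat \<Rightarrow> 'a::comm_monoid_add"
  shows "(\<Sum>x\<in>corners F. g x) = (\<Sum>f\<in>F. g (f, 0) + g (f, 1) + g (f, 2))"
proof -
  have "(\<Sum>x\<in>corners F. g x) = (\<Sum>f\<in>F. \<Sum>c\<in>{0,1,2}. g (f, c))"
    unfolding corners_def sum.cartesian_product by (rule sum.cong) auto
  also have "\<dots> = (\<Sum>f\<in>F. g (f, 0) + g (f, 1) + g (f, 2))"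
    by (simp add: add.assoc)
  finally show ?thesis .
qed

locale ideal_triangulation =
  fixes F :: "'f set" and lab :: "'f \<times> nat \<Rightarrow> 'v::finite" and l0 :: "'f \<times> nat \<Rightarrow> real"
  assumes finite_faces: "finite F"
    and lab_surj: "lab ` corners F = UNIV"
    and l0_pos: "s \<in> sides F \<Longrightarrow> l0 s > 0"
begin

abbreviation W :: "(real^'v) set" where "W \<equiv> admissible F lab l0"
abbreviation \<psi> :: "real^'v \<Rightarrow> real^'v" where "\<psi> \<equiv> bdry_length F lab l0"

definition edge_sum :: "real^'v \<Rightarrow> 'f \<times> nat \<Rightarrow> real" where
  "edge_sum w s = w $ end1 lab s + w $ end2 lab s"

text \<open>The double-argument formula \<open>cosh l = 2 * (cosh (l / 2))\<^sup>2 - 1\<close> for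
  the conformal metric. It bypasses the arcosh in \<open>conf_metric\<close> and is smooth in
  \<open>w\<close> even outside \<open>W\<close>.\<close>

definition edge_cosh :: "real^'v \<Rightarrow> 'f \<times> nat \<Rightarrow> real" where
  "edge_cosh w s = 2 * (exp (2 * edge_sum w s) * (cosh (l0 s / 2))\<^sup>2) - 1"

definition arc_cosh :: "real^'v \<Rightarrow> 'f \<times> nat \<Rightarrow> real" where
  "arc_cosh w x = hex_ratio (edge_cosh w x) (edge_cosh w (fst x, nx 1 (snd x))) (edge_cosh w (fst x, nx 2 (snd x)))"

lemma finite_corners: "finite (corners F)"
  using finite_faces by (simp add: corners_def)

lemma ln_cosh_pos: "s \<in> sides F \<Longrightarrow> ln (cosh (l0 s / 2)) > 0"
  using l0_pos[of s] cosh_real_nonneg_less_iff[of 0 "l0 s / 2"] by simp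

lemma W_iff: "w \<in> W \<longleftrightarrow> (\<forall>s\<in>sides F. edge_sum w s > - ln (cosh (l0 s / 2)))"
  by (simp add: admissible_def edge_sum_def)

lemma continuous_edge_sum [continuous_intros]: "continuous_on A (\<lambda>w. edge_sum w s)"
  unfolding edge_sum_def by (intro continuous_intros)

lemma open_W: "open W"
proof -
  have "W = (\<Inter>s\<in>sides F. {w. - ln (cosh (l0 s / 2)) < edge_sum w s})"
    by (auto simp: W_iff)
  moreover have "finite (sides F)" using finite_corners by (simp add: corners_eq_sides)
  moreover have "open {w. - ln (cosh (l0 s / 2)) < edge_sum w s}" for s
    by (intro open_Collect_less continuous_intros)
  ultimately show ?thesis by (simp add: open_INT)
qed

lemma edge_sum_line: "edge_sum (w + t *\<^sub>R v) s = edge_sum w s + t * edge_sum v s"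
  by (simp add: edge_sum_def algebra_simps)

lemma edge_sum_add_scaleR: "edge_sum (a *\<^sub>R w + b *\<^sub>R v) s = a * edge_sum w s + b * edge_sum v s"
  by (simp add: edge_sum_def algebra_simps)

lemma convex_W: "convex W"
  unfolding convex_alt
proof (intro ballI allI impI)
  fix w v u assume *: "w \<in> W" "v \<in> W" "0 \<le> u \<and> u \<le> (1::real)"
  show "(1 - u) *\<^sub>R w + u *\<^sub>R v \<in> W"
    unfolding W_iff edge_sum_add_scaleR
  proof
    fix s assume "s \<in> sides F"
    then have "- edge_sum w s < ln (cosh (l0 s / 2))" "- edge_sum v s < ln (cosh (l0 s / 2))"
      using * unfolding W_iff by force+
    then show "- ln (cosh (l0 s / 2)) < (1 - u) * edge_sum w s + u * edge_sum v s"
      using convex_bound_lt[of "- edge_sum w s" "ln (cosh (l0 s / 2))" "- edge_sum v s" "1 - u" u] *(3)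
      by force
  qed
qed

lemma zero_in_W: "0 \<in> W"
  using ln_cosh_pos by (auto simp: W_iff edge_sum_def)

lemma edge_cosh_eq: "edge_cosh w s = 2 * (exp (edge_sum w s) * cosh (l0 s / 2))\<^sup>2 - 1"
  by (simp add: edge_cosh_def exp_double power_mult_distrib)

lemma conformal_cosh_gt_1:
  assumes "w \<in> W" "s \<in> sides F"
  shows "exp (edge_sum w s) * cosh (l0 s / 2) > 1"
proof -
  have "ln (exp (edge_sum w s) * cosh (l0 s / 2)) > 0"
    using assms by (auto simp: W_iff ln_mult add.commute)
  then show ?thesis by (simp add: ln_gt_zero_iff)
qed

lemma edge_cosh_gt_1:
  assumes "w \<in> W" "s \<in> sides F"
  shows "edge_cosh w s > 1"
  unfolding edge_cosh_eq using one_less_power[OF conformal_cosh_gt_1[OF assms], of 2] by simp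

lemma cosh_sinh_conf_metric:
  assumes "w \<in> W" "s \<in> sides F"
  shows "cosh (conf_metric lab l0 w s) = edge_cosh w s"
    and "sinh (conf_metric lab l0 w s) = sqrt ((edge_cosh w s)\<^sup>2 - 1)"
proof -
  let ?u = "exp (edge_sum w s) * cosh (l0 s / 2)"
  have l: "conf_metric lab l0 w s = 2 * arcosh ?u" by (simp add: conf_metric_def edge_sum_def)
  show c: "cosh (conf_metric lab l0 w s) = edge_cosh w s"
    unfolding l cosh_double_cosh edge_cosh_eq using conformal_cosh_gt_1[OF assms] by simp
  have "sinh (conf_metric lab l0 w s) \<ge> 0"
    unfolding l using conformal_cosh_gt_1[OF assms] by simp
  then show "sinh (conf_metric lab l0 w s) = sqrt ((edge_cosh w s)\<^sup>2 - 1)"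
    unfolding c[symmetric] by (simp add: cosh_square_eq)
qed

lemma barc_eq:
  assumes "w \<in> W" "x \<in> corners F"
  shows "barc (conf_metric lab l0 w) x = arcosh (arc_cosh w x)"
  using assms by (auto simp: barc_def arc_cosh_def hex_ratio_def Let_def corners_eq_sides
      cosh_sinh_conf_metric nx_sides)

lemma arc_cosh_gt_1:
  assumes "w \<in> W" "x \<in> corners F"
  shows "arc_cosh w x > 1"
  unfolding arc_cosh_def using assms
  by (intro hex_ratio_gt_1 edge_cosh_gt_1) (auto simp: corners_eq_sides nx_sides)

lemma \<psi>_nth:
  assumes "w \<in> W"
  shows "\<psi> w $ i = (\<Sum>x\<in>{x\<in>corners F. lab x = i}. arcosh (arc_cosh w x))"
  unfolding bdry_length_def using assms by (auto intro!: sum.cong barc_eq)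

text \<open>On \<open>W\<close> all edge and arc hyperbolic cosines exceed 1 strictly, so roots and
  arcosh are evaluated only where they are smooth.\<close>

lemma smooth_on_\<psi>: "smooth_on W \<psi>"
  unfolding smooth_on_def
proof
  fix k
  have es: "Ck_on k W (\<lambda>w. edge_sum w s)" for s
    unfolding edge_sum_def
    by (intro Ck_on_add Ck_on_bounded_linear open_W bounded_linear_vec_nth)
  have ec: "Ck_on k W (\<lambda>w. edge_cosh w s)" for s
    unfolding edge_cosh_def by (intro Ck_on_diff Ck_on_mult Ck_on_const Ck_on_exp_compose open_W es)
  have ac: "Ck_on k W (\<lambda>w. arc_cosh w x)" if "x \<in> corners F" for x
  proof -
    have *: "(edge_cosh w (fst x, nx j c))\<^sup>2 - 1 > 0" if "w \<in> W" for w j c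
      using edge_cosh_gt_1[OF that nx_sides, of x j c] \<open>x \<in> corners F\<close>
      by (simp add: corners_eq_sides power2_eq_square less_1_mult)
    have sq: "Ck_on k W (\<lambda>w. sqrt ((edge_cosh w (fst x, nx j c))\<^sup>2 - 1))" for j c
      by (rule Ck_on_sqrt_compose[OF open_W _ *])
        (unfold power2_eq_square, intro Ck_on_diff Ck_on_mult Ck_on_const open_W ec)
    have nz: "sqrt ((edge_cosh w (fst x, nx 1 (snd x)))\<^sup>2 - 1) * sqrt ((edge_cosh w (fst x, nx 2 (snd x)))\<^sup>2 - 1) \<noteq> 0"
      if "w \<in> W" for w using *[OF that, of 1 "snd x"] *[OF that, of 2 "snd x"] by simp
    show ?thesis unfolding arc_cosh_def hex_ratio_def
      by (intro Ck_on_divide[OF open_W _ _ nz] Ck_on_add Ck_on_mult open_W ec sq)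
  qed
  show "Ck_on k W \<psi>"
  proof (rule Ck_on_vec[OF open_W])
    fix i
    have "Ck_on k W (\<lambda>w. \<Sum>x\<in>{x\<in>corners F. lab x = i}. arcosh (arc_cosh w x))"
      by (intro Ck_on_sum Ck_on_arcosh_compose open_W ac arc_cosh_gt_1) auto
    then show "Ck_on k W (\<lambda>w. \<psi> w $ i)" by (rule Ck_on_cong[OF open_W]) (simp add: \<psi>_nth)
  qed
qed

section \<open>Negativity of the derivative and injectivity\<close>

lemma inner_\<psi>:
  assumes "w \<in> W"
  shows "\<psi> w \<bullet> v = (\<Sum>x\<in>corners F. v $ lab x * arcosh (arc_cosh w x))"
proof -
  have "\<psi> w \<bullet> v = (\<Sum>i\<in>UNIV. \<Sum>x\<in>{x\<in>corners F. lab x = i}. v $ lab x * arcosh (arc_cosh w x))"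
    unfolding inner_vec_def \<psi>_nth[OF assms] by (auto simp: sum_distrib_left mult.commute intro!: sum.cong)
  also have "\<dots> = (\<Sum>x\<in>corners F. v $ lab x * arcosh (arc_cosh w x))"
    by (rule sum.group) (auto simp: finite_corners)
  finally show ?thesis .
qed

text \<open>Pairing with \<open>v\<close> gives a sum over corners. Grouped by faces, each summand
  is a positive factor times the form of \<open>arc_rate_form\<close> at the values of
  \<open>v\<close> at the three corners. It is strictly negative at a face having a corner whose
  label \<open>i\<close> satisfies \<open>v $ i \<noteq> 0\<close>.\<close>

lemma \<psi>_line_deriv_neg:
  assumes w: "w + t *\<^sub>R v \<in> W" and "v \<noteq> 0"
  obtains D where "D < 0" "((\<lambda>t. \<psi> (w + t *\<^sub>R v) \<bullet> v) has_real_derivative D) (at t)"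
proof -
  let ?X = "edge_cosh (w + t *\<^sub>R v)"
  define R where "R x = arc_rate (?X x) (?X (fst x, nx 1 (snd x))) (?X (fst x, nx 2 (snd x)))
    (edge_sum v x) (edge_sum v (fst x, nx 1 (snd x))) (edge_sum v (fst x, nx 2 (snd x)))" for x
  define H where "H x = hex_disc (?X x) (?X (fst x, nx 1 (snd x))) (?X (fst x, nx 2 (snd x)))" for x
  define D where "D = (\<Sum>x\<in>corners F. v $ lab x * (2 * R x / sqrt (H x)))"
  have dX: "((\<lambda>t. edge_cosh (w + t *\<^sub>R v) s) has_real_derivative 2 * (?X s + 1) * edge_sum v s) (at t)" for s
    unfolding edge_cosh_def edge_sum_line by (auto intro!: derivative_eq_intros)
  have "((\<lambda>t. arcosh (arc_cosh (w + t *\<^sub>R v) x)) has_real_derivative 2 * R x / sqrt (H x)) (at t)"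
    if "x \<in> corners F" for x
    unfolding arc_cosh_def R_def H_def using w that
    by (intro arcosh_hex_ratio_deriv dX edge_cosh_gt_1) (auto simp: corners_eq_sides nx_sides)
  then have "((\<lambda>t. \<Sum>x\<in>corners F. v $ lab x * arcosh (arc_cosh (w + t *\<^sub>R v) x)) has_real_derivative D) (at t)"
    unfolding D_def by (intro DERIV_sum DERIV_cmult)
  then have "((\<lambda>t. \<psi> (w + t *\<^sub>R v) \<bullet> v) has_real_derivative D) (at t)"
  proof (rule has_field_derivative_transform_within_open)
    \<comment> \<open>The corner formula for \<open>\<psi>\<close> is available only on
      \<open>W\<close>, so the derivative is transferred on the open set of parameters whose point
      lies in \<open>W\<close>.\<close>
    show "open ((\<lambda>t. w + t *\<^sub>R v) -` W)"
      by (intro open_vimage open_W continuous_intros)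
  qed (use w in \<open>auto simp: inner_\<psi>\<close>)
  moreover have "D < 0"
  proof -
    define G where "G f = v $ lab (f,0) * R (f,0) + v $ lab (f,1) * R (f,1) + v $ lab (f,2) * R (f,2)" for f
    \<comment> \<open>The symmetry of \<open>hex_disc\<close> gives the three arcs of a face one
      common factor, so their rates combine into the single form \<open>G f\<close>.\<close>
    have H: "H (f, 1) = H (f, 0)" "H (f, 2) = H (f, 0)" for f
      by (simp_all add: H_def hex_disc_def algebra_simps)
    have Hpos: "H (f, 0) > 0" if "f \<in> F" for f
      unfolding H_def using that w by (intro hex_disc_pos edge_cosh_gt_1) (auto simp: sides_def)
    have D: "D = (\<Sum>f\<in>F. 2 / sqrt (H (f, 0)) * G f)"
      unfolding D_def sum_corners G_def H by (simp add: algebra_simps add_divide_distrib)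
    have G: "G f \<le> 0" "v $ lab (f,0) \<noteq> 0 \<or> v $ lab (f,1) \<noteq> 0 \<or> v $ lab (f,2) \<noteq> 0 \<Longrightarrow> G f < 0" if "f \<in> F" for f
    proof -
      have X: "?X (f, 0) > 1" "?X (f, 1) > 1" "?X (f, 2) > 1"
        using that w by (auto intro!: edge_cosh_gt_1 simp: sides_def)
      \<comment> \<open>The side opposite a corner joins the other two corners; this produces the
        sums \<open>v + w\<close>, \<open>w + u\<close>, \<open>u + v\<close> of
        \<open>arc_rate_form\<close>.\<close>
      have e: "edge_sum v (f, 0) = v $ lab (f,1) + v $ lab (f,2)"
        "edge_sum v (f, 1) = v $ lab (f,2) + v $ lab (f,0)"
        "edge_sum v (f, 2) = v $ lab (f,0) + v $ lab (f,1)"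
        by (simp_all add: edge_sum_def end1_def end2_def)
      have R: "R (f, 0) = arc_rate (?X (f, 0)) (?X (f, 1)) (?X (f, 2)) (edge_sum v (f, 0)) (edge_sum v (f, 1)) (edge_sum v (f, 2))"
        "R (f, 1) = arc_rate (?X (f, 1)) (?X (f, 2)) (?X (f, 0)) (edge_sum v (f, 1)) (edge_sum v (f, 2)) (edge_sum v (f, 0))"
        "R (f, 2) = arc_rate (?X (f, 2)) (?X (f, 0)) (?X (f, 1)) (edge_sum v (f, 2)) (edge_sum v (f, 0)) (edge_sum v (f, 1))"
        by (simp_all add: R_def)
      show "G f \<le> 0" "v $ lab (f,0) \<noteq> 0 \<or> v $ lab (f,1) \<noteq> 0 \<or> v $ lab (f,2) \<noteq> 0 \<Longrightarrow> G f < 0"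
        unfolding G_def R e by (rule arc_rate_form[OF X]; assumption)+
    qed
    obtain i where "v $ i \<noteq> 0" using \<open>v \<noteq> 0\<close> by (auto simp: vec_eq_iff)
    moreover obtain f c where fc: "(f, c) \<in> corners F" "lab (f, c) = i"
      using lab_surj by (metis UNIV_I imageE prod.collapse)
    ultimately have f: "f \<in> F" "G f < 0"
      using G(2)[of f] by (auto simp: corners_def)
    have coeff: "2 / sqrt (H (f, 0)) > 0" if "f \<in> F" for f using Hpos[OF that] by simp
    have "(\<Sum>f\<in>F. 2 / sqrt (H (f, 0)) * G f) < (\<Sum>f\<in>F. 0)"
    proof (rule sum_strict_mono_ex1[OF finite_faces])
      show "\<forall>f\<in>F. 2 / sqrt (H (f, 0)) * G f \<le> 0"
        using coeff G(1) by (meson less_imp_le mult_nonneg_nonpos)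
      show "\<exists>f\<in>F. 2 / sqrt (H (f, 0)) * G f < 0"
        using coeff f by (meson mult_pos_neg)
    qed
    then show "D < 0" unfolding D by simp
  qed
  ultimately show thesis by (rule that[rotated])
qed

text \<open>The segment from \<open>w\<close> to \<open>w'\<close> stays in the convex set
  \<open>W\<close>, and along it the inner product of \<open>\<psi>\<close> with
  \<open>w' - w\<close> strictly decreases.\<close>

lemma inj_on_\<psi>: "inj_on \<psi> W"
proof (rule inj_onI, rule ccontr)
  fix w w' assume w: "w \<in> W" "w' \<in> W" and eq: "\<psi> w = \<psi> w'" and "w \<noteq> w'"
  define v where "v = w' - w"
  have v: "v \<noteq> 0" using \<open>w \<noteq> w'\<close> by (simp add: v_def)
  have "\<psi> (w + 0 *\<^sub>R v) \<bullet> v > \<psi> (w + 1 *\<^sub>R v) \<bullet> v"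
  proof (rule DERIV_neg_imp_decreasing[of 0 1 "\<lambda>t. \<psi> (w + t *\<^sub>R v) \<bullet> v"])
    fix t :: real assume t: "0 \<le> t" "t \<le> 1"
    have "w + t *\<^sub>R v = (1 - t) *\<^sub>R w + t *\<^sub>R w'" by (simp add: v_def algebra_simps)
    then have "w + t *\<^sub>R v \<in> W" using convexD_alt[OF convex_W w t] by simp
    then show "\<exists>y. ((\<lambda>t. \<psi> (w + t *\<^sub>R v) \<bullet> v) has_real_derivative y) (at t) \<and> y < 0"
      using \<psi>_line_deriv_neg[OF _ v] by metis
  qed simp
  then show False using eq by (simp add: v_def)
qed

text \<open>A kernel vector \<open>v\<close> would make the derivative of the inner product of
  \<open>\<psi>\<close> with \<open>v\<close> along the line through \<open>w\<close> vanish,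
  whereas it is negative for \<open>v \<noteq> 0\<close>.\<close>

lemma frechet_derivative_\<psi>_nonzero:
  assumes w: "w \<in> W" and "frechet_derivative \<psi> (at w) v = 0"
  shows "v = 0"
proof (rule ccontr)
  assume "v \<noteq> 0"
  then obtain D where D: "D < 0" "((\<lambda>t. \<psi> (w + t *\<^sub>R v) \<bullet> v) has_real_derivative D) (at 0)"
    using \<psi>_line_deriv_neg[of w 0 v] w by auto
  have "(\<psi> has_derivative frechet_derivative \<psi> (at w)) (at w)"
    using smooth_on_\<psi> Ck_on_has_derivative w unfolding smooth_on_def by blast
  then have *: "(\<psi> has_derivative frechet_derivative \<psi> (at w)) (at (w + 0 *\<^sub>R v))" by simp
  have "((\<lambda>t. w + t *\<^sub>R v) has_derivative (\<lambda>t. t *\<^sub>R v)) (at 0)"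
    by (auto intro!: derivative_eq_intros)
  from has_derivative_inner_left[OF has_derivative_compose[OF this *], of v]
  have d: "((\<lambda>t. \<psi> (w + t *\<^sub>R v) \<bullet> v) has_derivative (\<lambda>t. frechet_derivative \<psi> (at w) (t *\<^sub>R v) \<bullet> v)) (at 0)" .
  have "frechet_derivative \<psi> (at w) (t *\<^sub>R v) = 0" for t
    using linear_cmul[OF has_derivative_linear[OF *]] assms(2) by simp
  with d have "((\<lambda>t. \<psi> (w + t *\<^sub>R v) \<bullet> v) has_derivative (\<lambda>t. 0)) (at 0)" by simp
  then have "((\<lambda>t. \<psi> (w + t *\<^sub>R v) \<bullet> v) has_real_derivative 0) (at 0)"
    unfolding has_field_derivative_def by (simp add: lambda_zero)
  then show False using DERIV_unique[OF D(2)] D(1) by simp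
qed

section \<open>Compactness from bounds on the boundary lengths\<close>

lemma edge_cosh_gt_1_imp_W:
  assumes "\<And>s. s \<in> sides F \<Longrightarrow> edge_cosh w s > 1"
  shows "w \<in> W"
  unfolding W_iff
proof
  fix s assume s: "s \<in> sides F"
  let ?u = "exp (edge_sum w s) * cosh (l0 s / 2)"
  have "?u\<^sup>2 > 1\<^sup>2" using assms[OF s] unfolding edge_cosh_eq by simp
  then have "?u > 1" by (rule power2_less_imp_less) simp
  then have "ln ?u > 0" by simp
  then show "- ln (cosh (l0 s / 2)) < edge_sum w s" by (simp add: ln_mult)
qed

text \<open>The two edges at a corner share its label, and their other ends are those of the
  opposite edge. Hence the quantity \<open>a / (b * c)\<close> of \<open>hex_ratio_ge\<close> and
  \<open>hex_ratio_le\<close> is \<open>exp (- 4 * w $ lab x)\<close> up to factors from the initial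
  metric.\<close>

lemma edge_sum_corner:
  assumes "x \<in> corners F"
  shows "edge_sum w (fst x, nx 1 (snd x)) + edge_sum w (fst x, nx 2 (snd x)) = edge_sum w x + 2 * w $ lab x"
  using assms by (auto simp: corners_def edge_sum_def end1_def end2_def)

lemma edge_sum_adjacent_ge:
  assumes "x \<in> corners F" "\<And>i. w $ i \<ge> - r"
  shows "edge_sum w (fst x, nx 1 (snd x)) \<ge> w $ lab x - r" "edge_sum w (fst x, nx 2 (snd x)) \<ge> w $ lab x - r"
  using assms(1) assms(2)[of "lab (fst x, nx 1 (snd x))"] assms(2)[of "lab (fst x, nx 2 (snd x))"]
  by (auto simp: corners_def edge_sum_def end1_def end2_def)

text \<open>This is properness of \<open>\<psi>\<close>. The set \<open>K\<close> is a box cut by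
  the closed conditions \<open>m \<le> edge_cosh w s\<close>; as \<open>m > 1\<close>, these keep it
  inside the open set \<open>W\<close>.\<close>

lemma preimage_subset_compact:
  assumes "\<epsilon> > 0" "M > 0"
  obtains K where "compact K" "K \<subseteq> W" "\<And>w. w \<in> W \<Longrightarrow> (\<And>i. \<epsilon> \<le> \<psi> w $ i \<and> \<psi> w $ i \<le> M) \<Longrightarrow> w \<in> K"
proof -
  define q where "q w s = exp (2 * edge_sum w s) * (cosh (l0 s / 2))\<^sup>2" for w s
  have ec: "edge_cosh w s = 2 * q w s - 1" for w s by (simp add: q_def edge_cosh_def)
  have q1: "q w s > 1" if "w \<in> W" "s \<in> sides F" for w s
    using edge_cosh_gt_1[OF that] by (simp add: ec)
  have fin: "finite (sides F)" using finite_corners by (simp add: corners_eq_sides)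
  define L where "L = Max (insert 1 ((\<lambda>s. (cosh (l0 s / 2))\<^sup>2) ` sides F))"
  have L: "(cosh (l0 s / 2))\<^sup>2 \<le> L" if "s \<in> sides F" for s
    unfolding L_def using fin that by (auto intro!: Max_ge)
  have L1: "L \<ge> 1" unfolding L_def using fin by (auto intro!: Max_ge)
  have cs1: "(cosh (l0 s / 2))\<^sup>2 \<ge> 1" for s using one_le_power[OF cosh_real_ge_1] .
  define C where "C = cosh M"
  have C: "C > 1" unfolding C_def using assms(2) cosh_real_nonneg_less_iff[of 0 M] by simp
  \<comment> \<open>\<open>m\<close> is the solution \<open>z > 1\<close> of
    \<open>z / sqrt (z\<^sup>2 - 1) = C\<close>, the least edge hyperbolic cosine compatible with
    arcs of hyperbolic cosine at most \<open>C\<close>.\<close>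
  define m where "m = sqrt (C\<^sup>2 / (C\<^sup>2 - 1))"
  have C2: "C\<^sup>2 > 1" using C by (intro one_less_power) auto
  have m: "m > 1" unfolding m_def using C2 by (simp add: less_divide_eq)
  \<comment> \<open>Chosen so that \<open>4 * C * L\<^sup>2 * exp (- 4 * R) = 1\<close>, the
    threshold reached in the lower bound for \<open>w\<close>.\<close>
  define R where "R = ln (4 * C * L\<^sup>2) / 4"
  define N where "N = real (card (corners F))"
  have "corners F \<noteq> {}" using lab_surj by auto
  then have N: "N > 0" unfolding N_def using finite_corners by (simp add: card_gt_0_iff)
  \<comment> \<open>If every arc at a boundary component had hyperbolic cosine below
    \<open>h\<close>, its at most \<open>N\<close> arcs would add up to less than
    \<open>\<epsilon>\<close>.\<close>
  define h where "h = cosh (\<epsilon> / N)"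
  have h: "h > 1" unfolding h_def using assms(1) N cosh_real_nonneg_less_iff[of 0 "\<epsilon> / N"] by simp
  \<comment> \<open>Later \<open>y = exp (- 2 * w $ i)\<close> and
    \<open>1 / Q = exp (2 * R) * y\<close>. The first condition yields \<open>Q \<ge> 2\<close>; the
    second bounds the estimate of \<open>hex_ratio_le\<close>, which tends to \<open>1 < h\<close>
    as \<open>y\<close> tends to 0.\<close>
  obtain \<delta> where \<delta>: "\<delta> > 0"
    "\<And>y. 0 < y \<Longrightarrow> y < \<delta> \<Longrightarrow> exp (2 * R) * y < 1 / 2 \<and> 2 * L * y\<^sup>2 + (1 + exp (2 * R) * y)\<^sup>2 < h"
  proof -
    have "((\<lambda>y. exp (2 * R) * y) \<longlongrightarrow> exp (2 * R) * 0) (at_right 0)"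
      "((\<lambda>y. 2 * L * y\<^sup>2 + (1 + exp (2 * R) * y)\<^sup>2) \<longlongrightarrow> 2 * L * 0\<^sup>2 + (1 + exp (2 * R) * 0)\<^sup>2) (at_right 0)"
      by (intro tendsto_intros)+
    then have "eventually (\<lambda>y. exp (2 * R) * y < 1 / 2 \<and> 2 * L * y\<^sup>2 + (1 + exp (2 * R) * y)\<^sup>2 < h) (at_right 0)"
      using h by (intro eventually_conj order_tendstoD(2)) auto
    then show thesis using that by (auto simp: eventually_at_right_field)
  qed
  define r where "r = - ln (\<delta> / 2) / 2"
  define K where "K = {w. (\<forall>i. - R \<le> w $ i \<and> w $ i \<le> r) \<and> (\<forall>s\<in>sides F. m \<le> edge_cosh w s)}"
  show thesis
  proof (rule that)
    have K: "K = cbox (\<chi> i. - R) (\<chi> i. r) \<inter> (\<Inter>s\<in>sides F. {w. m \<le> edge_cosh w s})"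
      by (auto simp: K_def mem_box_cart)
    have "closed {w. m \<le> edge_cosh w s}" for s
      unfolding edge_cosh_def by (intro closed_Collect_le continuous_intros)
    then show "compact K"
      unfolding K by (intro compact_Int_closed compact_cbox closed_INT ballI)
    show "K \<subseteq> W"
    proof
      fix w assume "w \<in> K"
      then have "edge_cosh w s > 1" if "s \<in> sides F" for s using m that unfolding K_def by force
      then show "w \<in> W" by (rule edge_cosh_gt_1_imp_W)
    qed
  next
    fix w assume w: "w \<in> W" and B: "\<And>i. \<epsilon> \<le> \<psi> w $ i \<and> \<psi> w $ i \<le> M"
    have arc0: "arcosh (arc_cosh w x) \<ge> 0" if "x \<in> corners F" for x
      using arc_cosh_gt_1[OF w that] by simp
    have arcC: "arc_cosh w x \<le> C" if x: "x \<in> corners F" for x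
    proof -
      have "arcosh (arc_cosh w x) \<le> \<psi> w $ lab x"
        unfolding \<psi>_nth[OF w] using x finite_corners arc0
        by (intro member_le_sum[where f = "\<lambda>x. arcosh (arc_cosh w x)"]) auto
      then have "arcosh (arc_cosh w x) \<le> M" using B[of "lab x"] by linarith
      then have "cosh (arcosh (arc_cosh w x)) \<le> cosh M"
        using arc0[OF x] assms(2) by (simp add: cosh_real_nonneg_le_iff)
      then show ?thesis using arc_cosh_gt_1[OF w x] by (simp add: C_def)
    qed
    have arcq: "arc_cosh w x = hex_ratio (2 * q w x - 1) (2 * q w (fst x, nx 1 (snd x)) - 1) (2 * q w (fst x, nx 2 (snd x)) - 1)" for x
      unfolding arc_cosh_def ec ..
    have adj: "x \<in> sides F" "(fst x, nx 1 (snd x)) \<in> sides F" "(fst x, nx 2 (snd x)) \<in> sides F" if "x \<in> corners F" for x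
      using that by (auto simp: corners_eq_sides nx_sides)
    have qq: "exp (2 * edge_sum w (fst x, nx 1 (snd x))) * exp (2 * edge_sum w (fst x, nx 2 (snd x)))
       = exp (2 * edge_sum w x) * exp (4 * w $ lab x)" if x: "x \<in> corners F" for x
      using edge_sum_corner[OF x, of w] unfolding exp_add[symmetric] by (simp add: algebra_simps)
    have edge: "m \<le> edge_cosh w s" if s: "s \<in> sides F" for s
    proof -
      \<comment> \<open>Advancing by 1 and then by 2 returns to the index of \<open>s\<close>, so
        \<open>s\<close> is one of the two edges adjacent to the arc at \<open>x\<close>.\<close>
      define x where "x = (fst s, nx 1 (snd s))"
      have x: "x \<in> corners F" using nx_sides[OF s] by (simp add: x_def corners_eq_sides)
      have xs: "(fst x, nx 2 (snd x)) = s" using s by (cases s) (auto simp: x_def sides_def)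
      define z where "z = edge_cosh w s"
      have z: "z > 1" unfolding z_def using edge_cosh_gt_1[OF w s] .
      have z2: "z\<^sup>2 > 1" using z by (intro one_less_power) auto
      have "z / sqrt (z\<^sup>2 - 1) < arc_cosh w x"
        unfolding arc_cosh_def xs z_def
        by (rule hex_ratio_gt_coth(2)) (use w adj[OF x] s in \<open>auto intro!: edge_cosh_gt_1\<close>)
      then have "z / sqrt (z\<^sup>2 - 1) \<le> C" using arcC[OF x] by simp
      then have "z \<le> C * sqrt (z\<^sup>2 - 1)" using z2 by (simp add: divide_le_eq)
      then have "z\<^sup>2 \<le> (C * sqrt (z\<^sup>2 - 1))\<^sup>2" using z by (intro power_mono) auto
      then have "z\<^sup>2 \<le> C\<^sup>2 * (z\<^sup>2 - 1)" using z2 by (simp add: power_mult_distrib)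
      then have "C\<^sup>2 / (C\<^sup>2 - 1) \<le> z\<^sup>2" using C2 by (simp add: field_simps)
      then have "m \<le> sqrt (z\<^sup>2)" unfolding m_def by (rule real_sqrt_le_mono)
      then show ?thesis using z by (simp add: z_def)
    qed
    have lower: "- R \<le> w $ i" for i
    proof -
      obtain x where x: "x \<in> corners F" "lab x = i" using lab_surj by (metis UNIV_I imageE)
      let ?a = "q w x" and ?b = "q w (fst x, nx 1 (snd x))" and ?c = "q w (fst x, nx 2 (snd x))"
      have q: "?a > 1" "?b > 1" "?c > 1" using q1[OF w] adj[OF x(1)] by auto
      \<comment> \<open>The factors of the initial metric lie between 1 and \<open>L\<close>, so
        \<open>?b * ?c\<close> is at most \<open>?a * exp (4 * w $ i) * (L * L)\<close>. A very
        negative \<open>w $ i\<close> would then make the arc too long.\<close>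
      have "?b * ?c = exp (2 * edge_sum w x) * exp (4 * w $ i) *
        ((cosh (l0 (fst x, nx 1 (snd x)) / 2))\<^sup>2 * (cosh (l0 (fst x, nx 2 (snd x)) / 2))\<^sup>2)"
        unfolding q_def using qq[OF x(1)] x(2) by (simp add: mult_ac)
      also have "\<dots> \<le> exp (2 * edge_sum w x) * exp (4 * w $ i) * (L * L)"
        using L adj[OF x(1)] L1 by (intro mult_left_mono mult_mono) auto
      also have "\<dots> \<le> ?a * exp (4 * w $ i) * (L * L)"
        unfolding q_def using cs1[of x] L1 by (intro mult_right_mono) auto
      finally have bc: "?b * ?c \<le> ?a * exp (4 * w $ i) * (L * L)" .
      have "?a / (4 * (?b * ?c)) \<le> C" using hex_ratio_ge[OF q] arcC[OF x(1)] unfolding arcq by linarith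
      then have "?a \<le> C * (4 * (?b * ?c))" using q by (simp add: divide_le_eq)
      also have "\<dots> \<le> C * (4 * (?a * exp (4 * w $ i) * (L * L)))"
        using bc C by (intro mult_left_mono) auto
      finally have "?a * 1 \<le> ?a * (4 * C * L\<^sup>2 * exp (4 * w $ i))" by (simp add: power2_eq_square mult_ac)
      then have "1 \<le> 4 * C * L\<^sup>2 * exp (4 * w $ i)" using q by (simp only: mult_le_cancel_left_pos)
      then have "ln 1 \<le> ln (4 * C * L\<^sup>2 * exp (4 * w $ i))" using C L1 by (subst ln_le_cancel_iff) auto
      also have "\<dots> = ln (4 * C * L\<^sup>2) + 4 * w $ i" using C L1 by (subst ln_mult) auto
      finally show ?thesis by (simp add: R_def)
    qed
    have upper: "w $ i \<le> r" for i
    proof (rule ccontr)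
      assume "\<not> w $ i \<le> r"
      define y where "y = exp (- 2 * w $ i)"
      have "- 2 * w $ i < ln (\<delta> / 2)" using \<open>\<not> w $ i \<le> r\<close> by (simp add: r_def)
      then have "y < exp (ln (\<delta> / 2))" unfolding y_def by simp
      then have y: "0 < y" "y < \<delta>" using \<delta>(1) by (simp_all add: y_def)
      \<comment> \<open>Both edges adjacent to an arc at \<open>i\<close> have edge sum at least
        \<open>w $ i - R\<close> by the lower bound just shown, so their \<open>q\<close> is at
        least \<open>Q\<close>.\<close>
      define Q where "Q = exp (2 * (w $ i - R))"
      have Qy: "1 / Q = exp (2 * R) * y"
        unfolding Q_def y_def exp_add[symmetric] by (simp add: exp_minus[symmetric] inverse_eq_divide[symmetric] algebra_simps)
      have "1 / Q < 1 / 2" using \<delta>(2)[OF y] Qy by simp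
      then have Q: "Q \<ge> 2" unfolding Q_def by (simp add: field_simps)
      have small: "arcosh (arc_cosh w x) < \<epsilon> / N" if x: "x \<in> corners F" "lab x = i" for x
      proof -
        let ?a = "q w x" and ?b = "q w (fst x, nx 1 (snd x))" and ?c = "q w (fst x, nx 2 (snd x))"
        have a: "?a > 1" using q1[OF w] adj[OF x(1)] by auto
        have qge: "q w s \<ge> exp (2 * edge_sum w s)" for s
          unfolding q_def using cs1[of s] by simp
        have b: "?b \<ge> Q" and c: "?c \<ge> Q"
          using edge_sum_adjacent_ge[OF x(1) lower] x(2)
          by (auto simp: Q_def intro!: order_trans[OF _ qge])
        have "?a \<le> exp (2 * edge_sum w x) * L"
          unfolding q_def using L adj[OF x(1)] by (intro mult_left_mono) auto
        also have "exp (2 * edge_sum w x) = exp (2 * edge_sum w (fst x, nx 1 (snd x))) * exp (2 * edge_sum w (fst x, nx 2 (snd x))) * y\<^sup>2"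
          unfolding qq[OF x(1)] y_def x(2) exp_double[symmetric] by (simp add: mult.assoc exp_add[symmetric])
        also have "\<dots> * L \<le> ?b * ?c * y\<^sup>2 * L"
          using qge L1 Q b c by (intro mult_right_mono mult_mono) auto
        finally have "?a / (?b * ?c) \<le> L * y\<^sup>2" using Q b c by (simp add: divide_le_eq mult_ac)
        then have "arc_cosh w x \<le> 2 * (L * y\<^sup>2) + (1 + 1 / Q)\<^sup>2"
          using hex_ratio_le[OF a b c Q] unfolding arcq by linarith
        then have "arc_cosh w x < h" using \<delta>(2)[OF y] unfolding Qy by simp
        then have "cosh (arcosh (arc_cosh w x)) < cosh (\<epsilon> / N)"
          using arc_cosh_gt_1[OF w x(1)] by (simp add: h_def)
        then show ?thesis using arc0[OF x(1)] assms(1) N by (simp add: cosh_real_nonneg_less_iff)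
      qed
      let ?S = "{x \<in> corners F. lab x = i}"
      have "?S \<noteq> {}" using lab_surj by (metis (mono_tags, lifting) UNIV_I empty_iff imageE mem_Collect_eq)
      then have "card ?S > 0" using finite_corners by (simp add: card_gt_0_iff)
      then have "\<psi> w $ i < of_nat (card ?S) * (\<epsilon> / N)"
        unfolding \<psi>_nth[OF w] using small by (intro sum_bounded_above_strict) auto
      also have "\<dots> \<le> N * (\<epsilon> / N)"
        unfolding N_def using assms(1) finite_corners by (intro mult_right_mono) (auto intro!: card_mono)
      also have "\<dots> = \<epsilon>" using N by simp
      finally show False using B[of i] by simp
    qed
    show "w \<in> K" using edge lower upper by (simp add: K_def)
  qed
qed

section \<open>The image is the positive orthant\<close>

lemma \<psi>_pos:
  assumes "w \<in> W"
  shows "\<psi> w $ i > 0"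
proof -
  obtain x where "x \<in> corners F" "lab x = i" using lab_surj by (metis UNIV_I imageE)
  then have "{x \<in> corners F. lab x = i} \<noteq> {}" by blast
  moreover have "arcosh (arc_cosh w x) > 0" if "x \<in> corners F" for x
    using arc_cosh_gt_1[OF assms that] by simp
  ultimately show ?thesis
    unfolding \<psi>_nth[OF assms] using finite_corners by (intro sum_pos) auto
qed

lemma image_\<psi>: "\<psi> ` W = {x. \<forall>i. x $ i > 0}"
proof -
  let ?T = "{x :: real^'v. \<forall>i. x $ i > 0}"
  have cont: "continuous_on W \<psi>" using smooth_on_\<psi> unfolding smooth_on_def by (metis Ck_on.simps(1))
  have sub: "\<psi> ` W \<subseteq> ?T" using \<psi>_pos by auto
  have "open (\<psi> ` W)" by (rule invariance_of_domain[OF cont open_W inj_on_\<psi>])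
  then have op: "openin (top_of_set ?T) (\<psi> ` W)" using sub by (rule open_subset[rotated])
  have "?T \<inter> closure (\<psi> ` W) \<subseteq> \<psi> ` W"
  proof
    fix b assume b: "b \<in> ?T \<inter> closure (\<psi> ` W)"
    \<comment> \<open>Halving the minimum and adding 1 to the maximum puts \<open>b\<close> strictly
      inside the open box \<open>?U\<close>.\<close>
    define \<epsilon> where "\<epsilon> = Min (range (\<lambda>i. b $ i)) / 2"
    define M where "M = Max (range (\<lambda>i. b $ i)) + 1"
    have "Min (range (\<lambda>i. b $ i)) > 0" using b by simp
    moreover have "Min (range (\<lambda>i. b $ i)) \<le> b $ i" for i by (rule Min_le) auto
    ultimately have e: "\<epsilon> > 0" "\<epsilon> < b $ i" for i
      unfolding \<epsilon>_def by (simp, smt (verit) field_sum_of_halves)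
    have "b $ i \<le> Max (range (\<lambda>i. b $ i))" for i by (rule Max_ge) auto
    then have M: "b $ i < M" for i unfolding M_def by (smt (verit))
    have "M > 0" using e(1) e(2)[of undefined] M[of undefined] by linarith
    then obtain K where K: "compact K" "K \<subseteq> W"
      "\<And>w. w \<in> W \<Longrightarrow> (\<And>i. \<epsilon> \<le> \<psi> w $ i \<and> \<psi> w $ i \<le> M) \<Longrightarrow> w \<in> K"
      using preimage_subset_compact[OF e(1)] by metis
    let ?U = "box (\<chi> i. \<epsilon>) (\<chi> i. M) :: (real^'v) set"
    have "b \<in> ?U" using e M by (simp add: mem_box_cart)
    then have "b \<in> closure (?U \<inter> \<psi> ` W)" using open_Int_closure_subset[of ?U "\<psi> ` W"] b by auto
    moreover have "?U \<inter> \<psi> ` W \<subseteq> \<psi> ` K"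
      using K(3) by (auto simp: mem_box_cart less_imp_le)
    moreover have "closed (\<psi> ` K)"
      using compact_continuous_image[OF continuous_on_subset[OF cont K(2)] K(1)] by (rule compact_imp_closed)
    ultimately have "b \<in> \<psi> ` K" using closure_minimal by blast
    then show "b \<in> \<psi> ` W" using K(2) by auto
  qed
  then have "\<psi> ` W = ?T \<inter> closure (\<psi> ` W)" using sub closure_subset[of "\<psi> ` W"] by blast
  then have cl: "closedin (top_of_set ?T) (\<psi> ` W)" by (metis closed_closure closedin_closed_Int)
  have "convex ?T"
  proof -
    have "(1 - u) * c + u * d > 0" if "c > 0" "d > 0" "0 \<le> u" "u \<le> 1" for c d u :: real
      using convex_bound_lt[of "- c" 0 "- d" "1 - u" u] that by simp
    then show ?thesis by (auto simp: convex_alt)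
  qed
  then have "connected ?T" by (rule convex_connected)
  then have "\<psi> ` W = {} \<or> \<psi> ` W = ?T" using op cl unfolding connected_clopen by blast
  then show ?thesis using zero_in_W by auto
qed

lemma diffeomorphism_\<psi>: "diffeomorphism_onto W {x. \<forall>i. x $ i > 0} \<psi>"
proof -
  have "continuous_on W \<psi>" using smooth_on_\<psi> unfolding smooth_on_def by (metis Ck_on.simps(1))
  then have "open (\<psi> ` W)" by (rule invariance_of_domain[OF _ open_W inj_on_\<psi>])
  moreover have "smooth_on (\<psi> ` W) (inv_into W \<psi>)"
    by (rule smooth_on_inv_into[OF open_W inj_on_\<psi> smooth_on_\<psi> frechet_derivative_\<psi>_nonzero])
  ultimately show ?thesis
    unfolding diffeomorphism_onto_def bij_betw_def image_\<psi>
    using open_W inj_on_\<psi> smooth_on_\<psi> by simp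
qed

end

theorem theorem1p1:
  fixes F :: "'f set" and sig :: "'f \<times> nat \<Rightarrow> 'f \<times> nat" and rv :: "'f \<times> nat \<Rightarrow> bool"
    and lab :: "'f \<times> nat \<Rightarrow> 'v::finite" and l0 :: "'f \<times> nat \<Rightarrow> real"
  assumes "triangulated_closed_surface F sig rv lab"
    and "discrete_hyp_metric F sig l0"
  shows "diffeomorphism_onto (admissible F lab l0) {x :: real^'v. \<forall>i. x $ i > 0}
           (bdry_length F lab l0)"
proof -
  interpret ideal_triangulation F lab l0
    using assms by unfold_locales (auto simp: triangulated_closed_surface_def discrete_hyp_metric_def)
  show ?thesis by (rule diffeomorphism_\<psi>)
qed

end
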